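(* For integers $m,n$, there is a configuration of a set $P$ of $m$ points and a set $L$ of $n$ lines in $\mathbb{R}^3$ such that (i) the number of lines of $L$ in any common plane is $s=O(1)$, and (ii) $I(P,L)=\Omega(m^{2/3}n^{1/2}+m+n)$.
   Context: For a finite set $P$ of points and a finite set $L$ of lines in $\mathbb{R}^3$, $I(P,L)$ denotes the number of pairs $(p,\ell)\in P\times L$ with $p\in\ell$. Asymptotic notation $O,\Omega$ is with respect to $m,n$, with implied constants independent of $m,n$. *)

theory Defs
  imports "HOL-Analysis.Analysis"
begin

definition is_line :: "(real ^ 3) set \<Rightarrow> bool" where
  "is_line l \<longleftrightarrow> affine l \<and> aff_dim l = 1"

definition is_plane :: "(real ^ 3) set \<Rightarrow> bool" where
  "is_plane H \<longleftrightarrow> affine H \<and> aff_dim H = 2"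

definition incidences :: "(real ^ 3) set \<Rightarrow> (real ^ 3) set set \<Rightarrow> nat" where
  "incidences P L = card {(p, l). p \<in> P \<and> l \<in> L \<and> p \<in> l}"

end

theory Submission imports Defs begin

text \<open>Grid points \<open>(x, y, z)\<close>, lifted to the quadric \<open>w = x z - y\<^sup>2\<close> in four-space, are joined
  by many lines lying on the quadric: those with spatial direction \<open>(1, t, t\<^sup>2)\<close>. The quadric
  contains no plane, so a plane contains at most two of these lines. Projecting to three-space along
  the direction \<open>(0, \<lambda>, 1, \<lambda>\<^sup>2)\<close> preserves incidences, and if \<open>\<lambda>\<close> is not a root of an integer
  quadratic, it creates no new coplanar triples of lines. A box of \<open>k \<times> k r \<times> k r\<^sup>2\<close>
  points with slopes \<open>t < r\<close> yields about \<open>k\<^sup>3 r\<^sup>3\<close> points, \<open>k\<^sup>2 r\<^sup>4\<close> lines and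
  \<open>k\<^sup>3 r\<^sup>4\<close> incidences.\<close>

section \<open>The projection parameter and incidence counts\<close>

text \<open>Each nonzero integer triple excludes only finitely many reals, and there are countably
  many triples.\<close>

lemma ex_not_root_int_quadratic:
  "\<exists>x::real. \<forall>a b c::int. of_int a + of_int b * x + of_int c * x\<^sup>2 = 0 \<longrightarrow> a = 0 \<and> b = 0 \<and> c = 0"
proof -
  define R where "R = (\<lambda>(a::int, b::int, c::int). {x::real. of_int a + of_int b * x + of_int c * x\<^sup>2 = 0})"
  have fin: "finite (R u)" if "u \<noteq> (0, 0, 0)" for u
  proof -
    obtain a b c where u: "u = (a, b, c)" by (cases u) auto
    let ?p = "[:real_of_int a, of_int b, of_int c:]"
    have "?p \<noteq> 0" using that u by auto
    then have "finite {x. poly ?p x = 0}" by (rule poly_roots_finite)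
    moreover have "R u = {x. poly ?p x = 0}"
      unfolding R_def u by (auto simp: algebra_simps power2_eq_square)
    ultimately show ?thesis by simp
  qed
  have "countable (\<Union>u\<in>UNIV - {(0, 0, 0)}. R u)"
    by (intro countable_UN) (auto intro: countable_finite fin)
  then have "(\<Union>u\<in>UNIV - {(0, 0, 0)}. R u) \<noteq> UNIV"
    using uncountable_UNIV_real by metis
  then obtain x where "x \<notin> (\<Union>u\<in>UNIV - {(0, 0, 0)}. R u)" by blast
  then have "\<forall>a b c. of_int a + of_int b * x + of_int c * x\<^sup>2 = 0 \<longrightarrow> a = 0 \<and> b = 0 \<and> c = 0"
    unfolding R_def by fastforce
  then show ?thesis by blast
qed

lemma finite_superset_of_card:
  assumes "infinite U" "finite A" "A \<subseteq> U" "card A \<le> n"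
  obtains B where "A \<subseteq> B" "B \<subseteq> U" "finite B" "card B = n"
proof -
  have "infinite (U - A)" using assms by simp
  then obtain D where D: "D \<subseteq> U - A" "finite D" "card D = n - card A"
    using infinite_arbitrarily_large by metis
  have "card (A \<union> D) = n"
    using D assms by (subst card_Un_disjoint) auto
  then show thesis using D assms by (intro that[of "A \<union> D"]) auto
qed

lemma incidences_mono:
  assumes "finite P" "finite L" "P' \<subseteq> P" "L' \<subseteq> L"
  shows "incidences P' L' \<le> incidences P L"
  unfolding incidences_def
proof (rule card_mono)
  show "finite {(p, l). p \<in> P \<and> l \<in> L \<and> p \<in> l}"
    by (rule finite_subset[of _ "P \<times> L"]) (use assms in auto)
qed (use assms in auto)

lemma incidences_ge_card:
  assumes "finite P" "finite L" "inj_on f A"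
    and "\<And>a. a \<in> A \<Longrightarrow> fst (f a) \<in> P \<and> snd (f a) \<in> L \<and> fst (f a) \<in> snd (f a)"
  shows "card A \<le> incidences P L"
proof -
  have "card A = card (f ` A)" using assms by (simp add: card_image)
  also have "\<dots> \<le> incidences P L" unfolding incidences_def
  proof (rule card_mono)
    show "finite {(p, l). p \<in> P \<and> l \<in> L \<and> p \<in> l}"
      by (rule finite_subset[of _ "P \<times> L"]) (use assms in auto)
    show "f ` A \<subseteq> {(p, l). p \<in> P \<and> l \<in> L \<and> p \<in> l}"
      by (rule image_subsetI) (use assms(4) in \<open>simp add: case_prod_beta\<close>)
  qed
  finally show ?thesis .
qed

section \<open>The projected quadric and its lines\<close>

text \<open>The assumption says that 1, \<open>lam\<close> and \<open>lam\<close>^2 are linearly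
  independent over the rationals. It turns each degeneracy of the projection into integer
  identities.\<close>

locale projected_quadric =
  fixes lam :: real
  assumes lam_indep:
    "of_int a + of_int b * lam + of_int c * lam\<^sup>2 = 0 \<Longrightarrow> a = 0 \<and> b = 0 \<and> c = 0"
begin

text \<open>The image of (x, y, z, x z - y^2) under the linear map whose kernel is spanned by (0,
  \<open>lam\<close>, 1, \<open>lam\<close>^2).\<close>

definition qpoint :: "real \<Rightarrow> real \<Rightarrow> real \<Rightarrow> real ^ 3" where
  "qpoint x y z = vector [x, y - lam * z, x * z - y\<^sup>2 - lam\<^sup>2 * z]"

text \<open>Image of the lifted line through (0, y, z) with direction (1, t, t^2). The first
  coordinate survives the projection, so it serves as parameter.\<close>

definition qline :: "int \<Rightarrow> int \<Rightarrow> int \<Rightarrow> (real ^ 3) set" where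
  "qline t y z = range (\<lambda>x. qpoint x (y + t * x) (z + t\<^sup>2 * x))"

lemma qpoint_in_qline: "qpoint x (y + t * x) (z + t\<^sup>2 * x) \<in> qline t y z"
  unfolding qline_def by blast

lemma lam_indep2:
  assumes "of_int a - lam * of_int b = of_int a' - lam * of_int b'"
  shows "a = a' \<and> b = b'"
proof -
  have "of_int (a - a') + of_int (b' - b) * lam + of_int 0 * lam\<^sup>2 = 0"
    using assms by (simp add: algebra_simps)
  from lam_indep[OF this] show ?thesis by simp
qed

text \<open>On integer y and z the projection loses nothing, because \<open>lam\<close> is
  irrational and y - \<open>lam\<close> z already determines both.\<close>

lemma qpoint_inject:
  "qpoint x (of_int y) (of_int z) = qpoint x' (of_int y') (of_int z') \<longleftrightarrow> x = x' \<and> y = y' \<and> z = z'"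
proof
  assume eq: "qpoint x (of_int y) (of_int z) = qpoint x' (of_int y') (of_int z')"
  have "x = x'" using arg_cong[OF eq, of "\<lambda>v. v $ 1"] by (simp add: qpoint_def)
  moreover have "y = y' \<and> z = z'"
    by (rule lam_indep2) (use arg_cong[OF eq, of "\<lambda>v. v $ 2"] in \<open>simp add: qpoint_def\<close>)
  ultimately show "x = x' \<and> y = y' \<and> z = z'" by simp
qed auto

text \<open>The lifted height x (z + t^2 x) - (y + t x)^2 is affine in x: the terms t^2 x^2 cancel.
  This is why the quadric contains the line.\<close>

lemma qpoint_on_qline:
  "qpoint x (y + t * x) (z + t\<^sup>2 * x) =
    qpoint 0 y z + x *\<^sub>R vector [1, t - lam * t\<^sup>2, z - 2 * y * t - lam\<^sup>2 * t\<^sup>2]"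
  by (simp add: qpoint_def vec_eq_iff forall_3 algebra_simps power2_eq_square)

lemma is_line_qline: "is_line (qline t y z)"
proof -
  define D :: "real ^ 3" where
    "D = vector [1, t - lam * t\<^sup>2, z - 2 * y * t - lam\<^sup>2 * t\<^sup>2]"
  define A where "A = qpoint 0 y z"
  have D: "D \<noteq> 0"
  proof
    assume "D = 0"
    then have "D $ 1 = 0" by simp
    then show False by (simp add: D_def)
  qed
  have "qline t y z = range (\<lambda>x. A + x *\<^sub>R D)"
    unfolding qline_def by (simp add: qpoint_on_qline A_def D_def)
  also have "\<dots> = affine hull {A, A + D}"
  proof -
    have "u *\<^sub>R A + v *\<^sub>R (A + D) = A + v *\<^sub>R D" if "u + v = 1" for u v
    proof -
      have "u *\<^sub>R A + v *\<^sub>R (A + D) = (u + v) *\<^sub>R A + v *\<^sub>R D"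
        by (simp add: algebra_simps)
      then show ?thesis using that by simp
    qed
    then have "affine hull {A, A + D} = {A + v *\<^sub>R D | u v. u + v = 1}"
      unfolding affine_hull_2 by (metis (no_types, lifting))
    also have "\<dots> = range (\<lambda>x. A + x *\<^sub>R D)"
      by (auto intro: exI[of _ "1 - x" for x])
    finally show ?thesis by simp
  qed
  finally have "qline t y z = affine hull {A, A + D}" .
  then show ?thesis using D by (simp add: is_line_def aff_dim_affine_hull aff_dim_2)
qed

lemma qline_inject: "qline t y z = qline t' y' z' \<longleftrightarrow> t = t' \<and> y = y' \<and> z = z'"
proof
  assume eq: "qline t y z = qline t' y' z'"
  have on: "qpoint (of_int x) (of_int (y + t * x)) (of_int (z + t\<^sup>2 * x)) \<in> qline t' y' z'" for x :: int
    using qpoint_in_qline[of "of_int x" y t z] eq by simp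
  \<comment> \<open>Points of equal lines with the same first coordinate coincide. At integer x,
    \<open>qpoint_inject\<close> can compare them; x = 0 then gives y and z, and x = 1 gives
    t.\<close>
  have *: "y + t * x = y' + t' * x \<and> z + t\<^sup>2 * x = z' + t'\<^sup>2 * x" for x
  proof -
    obtain u :: real where u: "qpoint (of_int x) (of_int (y + t * x)) (of_int (z + t\<^sup>2 * x)) =
        qpoint u (y' + t' * u) (z' + t'\<^sup>2 * u)"
      using on[of x] unfolding qline_def by auto
    have "u = of_int x" using arg_cong[OF u, of "\<lambda>v. v $ 1"] by (simp add: qpoint_def)
    with u have "qpoint (of_int x) (of_int (y + t * x)) (of_int (z + t\<^sup>2 * x)) =
        qpoint (of_int x) (of_int (y' + t' * x)) (of_int (z' + t'\<^sup>2 * x))" by simp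
    then show ?thesis unfolding qpoint_inject by simp
  qed
  from *[of 0] *[of 1] show "t = t' \<and> y = y' \<and> z = z'" by simp
qed simp

section \<open>Coplanarity of the lines\<close>

text \<open>The equation \<open>z - z' = (t + t') (y - y')\<close> says that the lines on the quadric already meet or are
  parallel in four-space. The last equation determines \<open>t'\<close> and \<open>y'\<close> from \<open>p\<close>, \<open>t\<close> and \<open>y\<close>.\<close>

lemma coplanar_pair:
  fixes t y z t' y' z' :: int and p r s :: real
  assumes 1: "r + p * (t - lam * t\<^sup>2) + (z - 2 * y * t - lam\<^sup>2 * t\<^sup>2) = 0"
    and 2: "s + p * (y - lam * z) - y\<^sup>2 - lam\<^sup>2 * z = 0"
    and 3: "r + p * (t' - lam * t'\<^sup>2) + (z' - 2 * y' * t' - lam\<^sup>2 * t'\<^sup>2) = 0"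
    and 4: "s + p * (y' - lam * z') - y'\<^sup>2 - lam\<^sup>2 * z' = 0"
    and ne: "(t, y, z) \<noteq> (t', y', z')"
  shows "z - z' = (t + t') * (y - y')"
    and "p * (1 - (t + t') * lam) = lam\<^sup>2 * (t + t') + (y + y')"
proof -
  \<comment> \<open>The difference of the slopes of the fourth coordinate along the two lifted
    lines. Subtracting the paired hypotheses eliminates r and s.\<close>
  define v where "v = (z - 2 * y * t) - (z' - 2 * y' * t')"
  have e1: "p * (of_int (t - t') - lam * of_int (t\<^sup>2 - t'\<^sup>2)) =
      lam\<^sup>2 * of_int (t\<^sup>2 - t'\<^sup>2) - of_int v"
    using 1 3 unfolding v_def by (simp add: algebra_simps)
  have e2: "p * (of_int (y - y') - lam * of_int (z - z')) =
      lam\<^sup>2 * of_int (z - z') + of_int (y\<^sup>2 - y'\<^sup>2)"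
    using 2 4 by (simp add: algebra_simps)
  \<comment> \<open>Cross-multiplication eliminates p. The \<open>lam\<close>^3 terms on both sides
    agree, leaving an integer quadratic in \<open>lam\<close> whose three coefficients must
    vanish.\<close>
  have "(lam\<^sup>2 * of_int (t\<^sup>2 - t'\<^sup>2) - of_int v) * (of_int (y - y') - lam * of_int (z - z')) =
     (lam\<^sup>2 * of_int (z - z') + of_int (y\<^sup>2 - y'\<^sup>2)) *
     (of_int (t - t') - lam * of_int (t\<^sup>2 - t'\<^sup>2))"
    unfolding e1[symmetric] e2[symmetric] by (simp only: ac_simps)
  then have "of_int ((t - t') * (y\<^sup>2 - y'\<^sup>2) + (y - y') * v)
      + of_int (- ((t\<^sup>2 - t'\<^sup>2) * (y\<^sup>2 - y'\<^sup>2)) - (z - z') * v) * lam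
      + of_int ((t - t') * (z - z') - (y - y') * (t\<^sup>2 - t'\<^sup>2)) * lam\<^sup>2 = 0"
    unfolding of_int_add of_int_diff of_int_mult of_int_minus by algebra
  from lam_indep[OF this]
  have c0: "(t - t') * (y\<^sup>2 - y'\<^sup>2) + (y - y') * v = 0"
    and c1: "(t\<^sup>2 - t'\<^sup>2) * (y\<^sup>2 - y'\<^sup>2) + (z - z') * v = 0"
    and c2: "(t - t') * (z - z') = (y - y') * (t\<^sup>2 - t'\<^sup>2)"
    by auto
  have "z - z' = (t + t') * (y - y') \<and> p * (1 - (t + t') * lam) = lam\<^sup>2 * (t + t') + (y + y')"
  proof (cases "t = t'")
    case False
    have "(t - t') * (z - z') = (t - t') * ((t + t') * (y - y'))"
      using c2 by (simp add: algebra_simps power2_eq_square)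
    with False have z: "z - z' = (t + t') * (y - y')" by simp
    have "v = (z - z') - 2 * y * t + 2 * y' * t'" by (simp add: v_def)
    then have v: "v = - ((y + y') * (t - t'))" unfolding z by (simp add: algebra_simps)
    have "of_int (t - t') * (p * (1 - (t + t') * lam)) =
        of_int (t - t') * (lam\<^sup>2 * (t + t') + (y + y'))"
      using e1 unfolding v by (simp add: algebra_simps power2_eq_square)
    with False z show ?thesis by simp
  next
    case True
    have v: "v = (z - z') - 2 * t * (y - y')" using True by (simp add: v_def algebra_simps)
    \<comment> \<open>For t = t', \<open>c2\<close> may be void, but \<open>c0\<close> and
      \<open>c1\<close> say that v annihilates y - y' and z - z', which are not both zero. So the
      lifted lines are parallel.\<close>
    have "v = 0" using c0 c1 ne True by auto
    then have z: "z - z' = (t + t') * (y - y')" using v True by simp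
    with True ne have D: "y \<noteq> y'" by auto
    have "of_int (y - y') * (p * (1 - (t + t') * lam)) =
        of_int (y - y') * (lam\<^sup>2 * (t + t') + (y + y'))"
      using e2 unfolding z by (simp add: algebra_simps power2_eq_square)
    with D z show ?thesis by simp
  qed
  then show "z - z' = (t + t') * (y - y')"
    and "p * (1 - (t + t') * lam) = lam\<^sup>2 * (t + t') + (y + y')" by auto
qed

text \<open>Pairing the first line with each of the others gives two equations for the same slope p
  of the plane. Eliminating p leaves an integer quadratic in \<open>lam\<close> that identifies the
  other two lines.\<close>

lemma no_coplanar_triple:
  assumes H: "is_plane H" and sub: "qline t1 y1 z1 \<subseteq> H" "qline t2 y2 z2 \<subseteq> H" "qline t3 y3 z3 \<subseteq> H"
    and ne: "(t1, y1, z1) \<noteq> (t2, y2, z2)" "(t1, y1, z1) \<noteq> (t3, y3, z3)"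
  shows "(t2, y2, z2) = (t3, y3, z3)"
proof -
  have hull: "affine hull H = H" using H by (simp add: is_plane_def affine_hull_eq)
  have "aff_dim H = int (DIM(real ^ 3) - 1)" using H by (simp add: is_plane_def)
  then have "\<exists>a b. a \<noteq> 0 \<and> H = {x. a \<bullet> x = b}"
    using aff_dim_eq_hyperplane[of H] unfolding hull by simp
  then obtain a b where a: "a \<noteq> 0" and Hab: "H = {x. a \<bullet> x = b}" by blast
  \<comment> \<open>The first equation puts the point at x = 0 on the plane; the second makes the
    direction orthogonal to the normal.\<close>
  have eqs: "a $ 2 * (y - lam * z) + a $ 3 * (- y\<^sup>2 - lam\<^sup>2 * z) = b \<and>
      a $ 1 + a $ 2 * (t - lam * t\<^sup>2) + a $ 3 * (z - 2 * y * t - lam\<^sup>2 * t\<^sup>2) = 0"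
    if "qline t y z \<subseteq> H" for t y z :: int
  proof -
    have "qpoint x (of_int y + of_int t * x) (of_int z + (of_int t)\<^sup>2 * x) \<in> H" for x
      using that by (auto simp: qline_def)
    then have 0: "a \<bullet> (qpoint 0 (of_int y) (of_int z) + x *\<^sub>R vector [1, of_int t - lam * (of_int t)\<^sup>2,
        of_int z - 2 * of_int y * of_int t - lam\<^sup>2 * (of_int t)\<^sup>2]) = b" for x
      unfolding qpoint_on_qline Hab by simp
    from 0[of 0] have i: "a \<bullet> qpoint 0 (of_int y) (of_int z) = b" by simp
    from 0[of 1] i have "a \<bullet> vector [1, of_int t - lam * (of_int t)\<^sup>2,
        of_int z - 2 * of_int y * of_int t - lam\<^sup>2 * (of_int t)\<^sup>2] = 0"
      by (simp only: inner_add_right scaleR_one)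
    with i show ?thesis by (simp add: qpoint_def inner_vec_def sum_3)
  qed
  note e = eqs[OF sub(1)] eqs[OF sub(2)] eqs[OF sub(3)]
  show ?thesis
  proof (cases "a $ 3 = 0")
    case True
    \<comment> \<open>Such a plane contains at most one of the lines: the first equation fixes y -
      \<open>lam\<close> z, the second t - \<open>lam\<close> t^2, and each determines its integers.
      This contradicts the distinctness of the first two lines.\<close>
    have a2: "a $ 2 \<noteq> 0"
    proof
      assume "a $ 2 = 0"
      with e(1) True have "a $ 1 = 0" by simp
      with \<open>a $ 2 = 0\<close> True a show False by (simp add: vec_eq_iff forall_3)
    qed
    have "a $ 2 * (y1 - lam * z1) = a $ 2 * (y2 - lam * z2)" using e True by simp
    then have "y1 = y2 \<and> z1 = z2" using a2 by (intro lam_indep2) simp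
    moreover have "a $ 1 + a $ 2 * (t1 - lam * t1\<^sup>2) = a $ 1 + a $ 2 * (t2 - lam * t2\<^sup>2)"
      using e(1,2) True by simp
    then have "t1 = t2 \<and> t1\<^sup>2 = t2\<^sup>2" using a2 by (intro lam_indep2) simp
    ultimately show ?thesis using ne by simp
  next
    case False
    define p r s where "p = a $ 2 / a $ 3" and "r = a $ 1 / a $ 3" and "s = - b / a $ 3"
    have prs: "a $ 2 = p * a $ 3" "a $ 1 = r * a $ 3" "b = - s * a $ 3"
      using False by (simp_all add: p_def r_def s_def)
    have scaled: "r + p * (t - lam * t\<^sup>2) + (z - 2 * y * t - lam\<^sup>2 * t\<^sup>2) = 0"
      "s + p * (y - lam * z) - y\<^sup>2 - lam\<^sup>2 * z = 0" if "qline t y z \<subseteq> H" for t y z :: int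
    proof -
      have "a $ 3 * (r + p * (t - lam * t\<^sup>2) + (z - 2 * y * t - lam\<^sup>2 * t\<^sup>2)) = 0"
        and "a $ 3 * (s + p * (y - lam * z) - y\<^sup>2 - lam\<^sup>2 * z) = 0"
        using eqs[OF that] unfolding prs by (simp_all add: algebra_simps)
      then show "r + p * (t - lam * t\<^sup>2) + (z - 2 * y * t - lam\<^sup>2 * t\<^sup>2) = 0"
        "s + p * (y - lam * z) - y\<^sup>2 - lam\<^sup>2 * z = 0" using False by simp_all
    qed
    note pair = coplanar_pair[OF scaled scaled]
    have A: "p * (1 - (t1 + t2) * lam) = lam\<^sup>2 * (t1 + t2) + (y1 + y2)"
      using pair(2)[OF sub(1,1,2,2)] ne by simp
    have B: "p * (1 - (t1 + t3) * lam) = lam\<^sup>2 * (t1 + t3) + (y1 + y3)"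
      using pair(2)[OF sub(1,1,3,3)] ne by simp
    \<comment> \<open>Again the \<open>lam\<close>^3 terms cancel; the constant and leading
      coefficients are y2 - y3 and t2 - t3.\<close>
    have "(lam\<^sup>2 * (t1 + t2) + (y1 + y2)) * (1 - (t1 + t3) * lam) =
        (lam\<^sup>2 * (t1 + t3) + (y1 + y3)) * (1 - (t1 + t2) * lam)"
      unfolding A[symmetric] B[symmetric] by (simp only: ac_simps)
    then have "of_int (y2 - y3) + of_int ((y1 + y3) * (t1 + t2) - (y1 + y2) * (t1 + t3)) * lam
        + of_int (t2 - t3) * lam\<^sup>2 = 0"
      unfolding of_int_add of_int_diff of_int_mult by algebra
    from lam_indep[OF this] have yt: "y2 = y3" "t2 = t3" by auto
    \<comment> \<open>If the second and third lines differed, their own pair relation would give z2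
      - z3 = (t2 + t3) (y2 - y3) = 0.\<close>
    show ?thesis
      using pair(1)[OF sub(2,2,3,3)] yt by fastforce
  qed
qed

section \<open>Padding and the trivial configurations\<close>

text \<open>An infinite supply of lines: the coplanarity bound holds for the whole family, so
  padding from it is harmless.\<close>

definition qlines :: "(real ^ 3) set set" where
  "qlines = {qline t y z | t y z. True}"

lemma infinite_qlines: "infinite qlines"
proof -
  have "infinite (range (\<lambda>t. qline t 0 0))"
    using infinite_UNIV_int by (subst finite_image_iff) (auto simp: inj_on_def qline_inject)
  moreover have "range (\<lambda>t. qline t 0 0) \<subseteq> qlines" unfolding qlines_def by blast
  ultimately show ?thesis using infinite_super by blast
qed

lemma card_qlines_in_plane:
  assumes "L \<subseteq> qlines" "is_plane H"
  shows "card {l \<in> L. l \<subseteq> H} \<le> 2"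
proof (rule ccontr)
  assume "\<not> card {l \<in> L. l \<subseteq> H} \<le> 2"
  then have "3 \<le> card {l \<in> L. l \<subseteq> H}" by simp
  then obtain S where S: "S \<subseteq> {l \<in> L. l \<subseteq> H}" "card S = 3"
    by (rule obtain_subset_with_card_n)
  then obtain l1 l2 l3 where l: "S = {l1, l2, l3}" "l1 \<noteq> l2" "l2 \<noteq> l3" "l1 \<noteq> l3"
    by (auto simp: card_3_iff)
  have mem: "\<exists>t y z. l = qline t y z \<and> qline t y z \<subseteq> H" if "l \<in> S" for l
    using that S(1) assms(1) unfolding qlines_def by fastforce
  obtain t1 y1 z1 where 1: "l1 = qline t1 y1 z1" "qline t1 y1 z1 \<subseteq> H" using mem[of l1] l by auto
  obtain t2 y2 z2 where 2: "l2 = qline t2 y2 z2" "qline t2 y2 z2 \<subseteq> H" using mem[of l2] l by auto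
  obtain t3 y3 z3 where 3: "l3 = qline t3 y3 z3" "qline t3 y3 z3 \<subseteq> H" using mem[of l3] l by auto
  have "(t2, y2, z2) = (t3, y3, z3)"
    by (rule no_coplanar_triple[OF assms(2) 1(2) 2(2) 3(2)]) (use l 1 2 3 in auto)
  then show False using l 2 3 by auto
qed

text \<open>Upper bounds on the two cardinalities suffice in the constructions: added points may be
  arbitrary, added lines come from \<open>qlines\<close>, and no incidence is lost.\<close>

lemma extend_configuration:
  assumes "finite P0" "card P0 \<le> m" "finite L0" "card L0 \<le> n" "L0 \<subseteq> qlines"
  shows "\<exists>P L. finite P \<and> card P = m \<and> finite L \<and> card L = n \<and> (\<forall>l\<in>L. is_line l) \<and>
    (\<forall>H. is_plane H \<longrightarrow> card {l \<in> L. l \<subseteq> H} \<le> 2) \<and> incidences P0 L0 \<le> incidences P L"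
proof -
  have "infinite (UNIV :: (real ^ 3) set)" by (rule infinite_UNIV_char_0)
  then obtain P where P: "P0 \<subseteq> P" "finite P" "card P = m"
    using finite_superset_of_card[of UNIV P0 m] assms by blast
  obtain L where L: "L0 \<subseteq> L" "L \<subseteq> qlines" "finite L" "card L = n"
    using finite_superset_of_card[OF infinite_qlines, of L0 n] assms by blast
  have "\<forall>l\<in>L. is_line l" using L(2) is_line_qline unfolding qlines_def by blast
  then show ?thesis
    using P L card_qlines_in_plane[OF L(2)] incidences_mono[OF P(2) L(3) P(1) L(1)] by blast
qed

lemma configuration_ge_points:
  "\<exists>P L. finite P \<and> card P = m \<and> finite L \<and> card L \<le> 1 \<and> L \<subseteq> qlines \<and> m \<le> incidences P L"
proof -
  define f where "f = (\<lambda>i::nat. qpoint (real i) 0 0)"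
  have inj: "inj f"
    by (rule injI) (use qpoint_inject[of _ 0 0 _ 0 0] in \<open>simp add: f_def\<close>)
  have "card {..<m} \<le> incidences (f ` {..<m}) {qline 0 0 0}"
  proof (rule incidences_ge_card[of _ _ "\<lambda>i. (f i, qline 0 0 0)"])
    show "inj_on (\<lambda>i. (f i, qline 0 0 0)) {..<m}" using inj by (simp add: inj_on_def)
    show "fst (f i, qline 0 0 0) \<in> f ` {..<m} \<and> snd (f i, qline 0 0 0) \<in> {qline 0 0 0} \<and>
        fst (f i, qline 0 0 0) \<in> snd (f i, qline 0 0 0)" if "i \<in> {..<m}" for i
      using that qpoint_in_qline[of "real i" 0 0 0] by (simp add: f_def)
  qed auto
  moreover have "card (f ` {..<m}) = m" using inj by (simp add: card_image inj_on_def)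
  moreover have "{qline 0 0 0} \<subseteq> qlines" unfolding qlines_def by blast
  ultimately show ?thesis
    by (intro exI[of _ "f ` {..<m}"] exI[of _ "{qline 0 0 0}"]) simp
qed

lemma configuration_ge_lines:
  "\<exists>P L. finite P \<and> card P \<le> 1 \<and> finite L \<and> card L = n \<and> L \<subseteq> qlines \<and> n \<le> incidences P L"
proof -
  define f where "f = (\<lambda>i::nat. qline (int i) 0 0)"
  have inj: "inj f" by (rule injI) (simp add: f_def qline_inject)
  have "card {..<n} \<le> incidences {qpoint 0 0 0} (f ` {..<n})"
  proof (rule incidences_ge_card[of _ _ "\<lambda>i. (qpoint 0 0 0, f i)"])
    show "inj_on (\<lambda>i. (qpoint 0 0 0, f i)) {..<n}" using inj by (simp add: inj_on_def)
    show "fst (qpoint 0 0 0, f i) \<in> {qpoint 0 0 0} \<and> snd (qpoint 0 0 0, f i) \<in> f ` {..<n} \<and>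
        fst (qpoint 0 0 0, f i) \<in> snd (qpoint 0 0 0, f i)" if "i \<in> {..<n}" for i
      using that qpoint_in_qline[of 0 0 "int i" 0] by (simp add: f_def)
  qed auto
  moreover have "card (f ` {..<n}) = n" using inj by (simp add: card_image inj_on_def)
  moreover have "f ` {..<n} \<subseteq> qlines" unfolding qlines_def f_def by blast
  ultimately show ?thesis
    by (intro exI[of _ "{qpoint 0 0 0}"] exI[of _ "f ` {..<n}"]) simp
qed

section \<open>The grid construction\<close>

lemma grid_configuration:
  fixes k r :: nat
  shows "\<exists>P L. finite P \<and> card P \<le> 4 * k ^ 3 * r ^ 3 \<and> finite L \<and> card L \<le> k\<^sup>2 * r ^ 4 \<and>
    L \<subseteq> qlines \<and> k ^ 3 * r ^ 4 \<le> incidences P L"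
proof -
  define pt where "pt = (\<lambda>(x, y, z). qpoint (real x) (real y) (real z))"
  define ln where "ln = (\<lambda>(t, y, z). qline (int t) (int y) (int z))"
  \<comment> \<open>The factors 2 leave room for y + t x and z + t^2 x: the starting values and the
    increments are each bounded by k r and k r^2 respectively.\<close>
  define X where "X = {..<k} \<times> {..<2 * k * r} \<times> {..<2 * k * r\<^sup>2}"
  define Y where "Y = {..<r} \<times> {..<k * r} \<times> {..<k * r\<^sup>2}"
  \<comment> \<open>Incidences are indexed by a line and an abscissa x < k, so every line
    contributes k of them.\<close>
  define f where "f = (\<lambda>(x, t, y, z). (pt (x, y + t * x, z + t\<^sup>2 * x), ln (t, y, z)))"
  have fin: "finite X" "finite Y" by (simp_all add: X_def Y_def)
  have "card (pt ` X) \<le> card X" "card (ln ` Y) \<le> card Y" by (simp_all add: fin card_image_le)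
  moreover have "card X = 4 * k ^ 3 * r ^ 3" "card Y = k\<^sup>2 * r ^ 4"
    by (simp_all add: X_def Y_def card_cartesian_product power2_eq_square power3_eq_cube power4_eq_xxxx)
  ultimately have cards: "card (pt ` X) \<le> 4 * k ^ 3 * r ^ 3" "card (ln ` Y) \<le> k\<^sup>2 * r ^ 4" by auto
  have "card ({..<k} \<times> Y) \<le> incidences (pt ` X) (ln ` Y)"
  proof (rule incidences_ge_card[where f = f])
    show "inj_on f ({..<k} \<times> Y)"
    proof (rule inj_onI)
      fix q q' assume "f q = f q'"
      moreover obtain x t y z where q: "q = (x, t, y, z)" by (cases q) auto
      moreover obtain x' t' y' z' where q': "q' = (x', t', y', z')" by (cases q') auto
      ultimately have eq: "qpoint (real x) (real (y + t * x)) (real (z + t\<^sup>2 * x)) =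
          qpoint (real x') (real (y' + t' * x')) (real (z' + t'\<^sup>2 * x'))"
        and "ln (t, y, z) = ln (t', y', z')"
        unfolding f_def pt_def by (simp_all only: prod.case prod.inject)
      then have l: "t = t' \<and> y = y' \<and> z = z'" by (simp add: ln_def qline_inject)
      have "x = x'" using arg_cong[OF eq, of "\<lambda>v. v $ 1"] by (simp add: qpoint_def)
      with l show "q = q'" by (simp add: q q')
    qed
    show "fst (f q) \<in> pt ` X \<and> snd (f q) \<in> ln ` Y \<and> fst (f q) \<in> snd (f q)" if q: "q \<in> {..<k} \<times> Y" for q
    proof -
      obtain x t y z where qe: "q = (x, t, y, z)" by (cases q) auto
      have b: "x < k" "t < r" "y < k * r" "z < k * r\<^sup>2" using q by (auto simp: qe Y_def)
      have "t * x \<le> k * r" using mult_mono[of t r x k] b by (simp add: mult.commute)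
      moreover have "t\<^sup>2 * x \<le> k * r\<^sup>2"
        using mult_mono[of "t\<^sup>2" "r\<^sup>2" x k] power_mono[of t r 2] b by (simp add: mult.commute)
      ultimately have "(x, y + t * x, z + t\<^sup>2 * x) \<in> X" using b by (simp add: X_def)
      then have "pt (x, y + t * x, z + t\<^sup>2 * x) \<in> pt ` X" by (rule imageI)
      moreover have "ln (t, y, z) \<in> ln ` Y" using b by (intro imageI) (simp add: Y_def)
      moreover have "pt (x, y + t * x, z + t\<^sup>2 * x) \<in> ln (t, y, z)"
        using qpoint_in_qline[of "real x" "int y" "int t" "int z"] by (simp add: pt_def ln_def)
      ultimately show ?thesis by (simp add: qe f_def)
    qed
  qed (use fin in auto)
  moreover have "card ({..<k} \<times> Y) = k ^ 3 * r ^ 4"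
    by (simp add: Y_def card_cartesian_product eval_nat_numeral)
  moreover have "ln ` Y \<subseteq> qlines" unfolding qlines_def ln_def by auto
  ultimately show ?thesis using fin cards
    by (intro exI[of _ "pt ` X"] exI[of _ "ln ` Y"]) auto
qed

section \<open>Choice of the grid parameters\<close>

lemma large_configuration:
  fixes m n :: nat
  assumes "m \<ge> 1" "n \<ge> 1"
  shows "\<exists>P L. finite P \<and> card P \<le> m \<and> finite L \<and> card L \<le> n \<and> L \<subseteq> qlines \<and>
    real (incidences P L) \<ge> 1 / 4 ^ 8 * (real m powr (2/3) * real n powr (1/2) + real m + real n)"
proof -
  define a b where "a = real m powr (1/3)" and "b = real n powr (1/2)"
  \<comment> \<open>The real solution of k^3 r^3 = m and k^2 r^4 = n. The main term is then W = m
    \<open>r0\<close> = n \<open>k0\<close>.\<close>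
  define k0 r0 where "k0 = a\<^sup>2 / b" and "r0 = b / a"
  define W where "W = real m powr (2/3) * real n powr (1/2)"
  have pos: "real m > 0" "real n > 0" using assms by auto
  then have ab: "a > 0" "b > 0" by (simp_all add: a_def b_def)
  have m_ab: "real m = a ^ 3" and n_ab: "real n = b\<^sup>2" and "real m powr (2/3) = a\<^sup>2"
    using pos by (simp_all add: a_def b_def powr_power)
  then have W_ab: "W = a\<^sup>2 * b" by (simp add: W_def b_def)
  have kr: "k0 > 0" "r0 > 0" using ab by (simp_all add: k0_def r0_def)
  have W_m: "W = real m * r0" and W_n: "W = real n * k0"
    and m_eq: "k0 ^ 3 * r0 ^ 3 = real m" and n_eq: "k0\<^sup>2 * r0 ^ 4 = real n"
    using ab by (simp_all add: m_ab n_ab W_ab k0_def r0_def field_simps eval_nat_numeral)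
  show ?thesis
  proof (cases "k0 \<ge> 2 \<and> r0 \<ge> 2")
    case True
    \<comment> \<open>Halving absorbs the factor 4 in the number of grid points. Since the halves
      are at least 1, rounding down costs at most another factor 2.\<close>
    define k r where "k = nat \<lfloor>k0 / 2\<rfloor>" and "r = nat \<lfloor>r0 / 2\<rfloor>"
    have half: "real (nat \<lfloor>u / 2\<rfloor>) \<le> u / 2 \<and> u / 4 \<le> real (nat \<lfloor>u / 2\<rfloor>)" if "u \<ge> 2" for u :: real
    proof -
      have 1: "real_of_int \<lfloor>u / 2\<rfloor> \<ge> 1" using that by simp
      then have "real (nat \<lfloor>u / 2\<rfloor>) = real_of_int \<lfloor>u / 2\<rfloor>" by simp
      then show ?thesis using 1 floor_correct[of "u / 2"] by linarith
    qed
    have k: "real k \<le> k0 / 2" "k0 / 4 \<le> real k" and r: "real r \<le> r0 / 2" "r0 / 4 \<le> real r"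
      using half True by (auto simp: k_def r_def)
    obtain P L where PL: "finite P" "card P \<le> 4 * k ^ 3 * r ^ 3" "finite L" "card L \<le> k\<^sup>2 * r ^ 4"
      "L \<subseteq> qlines" "k ^ 3 * r ^ 4 \<le> incidences P L"
      using grid_configuration by blast
    have "real (4 * k ^ 3 * r ^ 3) \<le> 4 * (k0 / 2) ^ 3 * (r0 / 2) ^ 3"
      unfolding of_nat_mult of_nat_power of_nat_numeral
      by (intro mult_mono power_mono k r) (use kr in auto)
    also have "\<dots> \<le> real m" unfolding m_eq[symmetric] using kr by (simp add: field_simps)
    finally have "card P \<le> m" using PL by linarith
    have "real (k\<^sup>2 * r ^ 4) \<le> (k0 / 2)\<^sup>2 * (r0 / 2) ^ 4"
      unfolding of_nat_mult of_nat_power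
      by (intro mult_mono power_mono k r) (use kr in auto)
    also have "\<dots> \<le> real n" unfolding n_eq[symmetric] using kr by (simp add: field_simps)
    finally have "card L \<le> n" using PL by linarith
    have "(k0 / 4) ^ 3 * (r0 / 4) ^ 4 \<le> real (k ^ 3 * r ^ 4)"
      unfolding of_nat_mult of_nat_power
      by (intro mult_mono power_mono k r) (use kr in auto)
    also have "\<dots> \<le> real (incidences P L)" using PL by (simp only: of_nat_le_iff)
    finally have I: "(k0 / 4) ^ 3 * (r0 / 4) ^ 4 \<le> real (incidences P L)" .
    have "(k0 / 4) ^ 3 * (r0 / 4) ^ 4 = (k0 ^ 3 * r0 ^ 3) * r0 / 4 ^ 7"
      by (simp add: power_divide eval_nat_numeral)
    also have "\<dots> = W / 4 ^ 7" unfolding m_eq W_m ..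
    finally have "W / 4 ^ 7 \<le> real (incidences P L)" using I by simp
    \<comment> \<open>Hence W + m + n is at most 2 W, which \<open>4 ^ 8\<close> in place of
      \<open>4 ^ 7\<close> absorbs.\<close>
    moreover have "2 * real m \<le> W" "2 * real n \<le> W"
      using True pos mult_left_mono[of 2 r0 "real m"] mult_left_mono[of 2 k0 "real n"]
      unfolding W_m[symmetric] W_n[symmetric] by auto
    ultimately have "1 / 4 ^ 8 * (W + real m + real n) \<le> real (incidences P L)" by simp
    then show ?thesis using PL \<open>card P \<le> m\<close> \<open>card L \<le> n\<close> unfolding W_def by blast
  next
    case False
    \<comment> \<open>Here W + m + n is at most 4 max(m, n), so collinear points or concurrent lines
      suffice.\<close>
    then have W: "W \<le> 2 * real m \<or> W \<le> 2 * real n"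
      using pos mult_left_mono[of r0 2 "real m"] mult_left_mono[of k0 2 "real n"]
      unfolding W_m[symmetric] W_n[symmetric] by auto
    show ?thesis
    proof (cases "n \<le> m")
      case True
      obtain P L where "finite P" "card P = m" "finite L" "card L \<le> 1" "L \<subseteq> qlines" "m \<le> incidences P L"
        using configuration_ge_points by blast
      moreover from this have "1 / 4 ^ 8 * (W + real m + real n) \<le> real (incidences P L)"
        using W True by auto
      ultimately show ?thesis using assms unfolding W_def
        by (intro exI[of _ P] exI[of _ L]) auto
    next
      case n: False
      obtain P L where "finite P" "card P \<le> 1" "finite L" "card L = n" "L \<subseteq> qlines" "n \<le> incidences P L"
        using configuration_ge_lines by blast
      moreover from this have "1 / 4 ^ 8 * (W + real m + real n) \<le> real (incidences P L)"
        using W n by auto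
      ultimately show ?thesis using assms unfolding W_def
        by (intro exI[of _ P] exI[of _ L]) auto
    qed
  qed
qed

end

theorem theorem1p5:
  shows "\<exists>(C::nat) (c::real). c > 0 \<and>
    (\<forall>(m::nat) (n::nat). m \<ge> 1 \<longrightarrow> n \<ge> 1 \<longrightarrow>
      (\<exists>(P :: (real ^ 3) set) (L :: (real ^ 3) set set).
         finite P \<and> card P = m \<and>
         finite L \<and> card L = n \<and> (\<forall>l\<in>L. is_line l) \<and>
         (\<forall>H. is_plane H \<longrightarrow> card {l \<in> L. l \<subseteq> H} \<le> C) \<and>
         real (incidences P L)
           \<ge> c * (real m powr (2/3) * real n powr (1/2) + real m + real n)))"
proof -
  obtain lam :: real where
    "\<forall>a b c::int. of_int a + of_int b * lam + of_int c * lam\<^sup>2 = 0 \<longrightarrow> a = 0 \<and> b = 0 \<and> c = 0"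
    using ex_not_root_int_quadratic by blast
  then interpret projected_quadric lam by unfold_locales blast
  show ?thesis
  proof (intro exI[of _ "2::nat"] exI[of _ "1 / 4 ^ 8 :: real"] conjI allI impI)
    fix m n :: nat
    assume "m \<ge> 1" "n \<ge> 1"
    then obtain P0 L0 where 0: "finite P0" "card P0 \<le> m" "finite L0" "card L0 \<le> n" "L0 \<subseteq> qlines"
      and I: "real (incidences P0 L0)
        \<ge> 1 / 4 ^ 8 * (real m powr (2/3) * real n powr (1/2) + real m + real n)"
      using large_configuration by blast
    obtain P L where "finite P \<and> card P = m \<and> finite L \<and> card L = n \<and> (\<forall>l\<in>L. is_line l) \<and>
        (\<forall>H. is_plane H \<longrightarrow> card {l \<in> L. l \<subseteq> H} \<le> 2)" and "incidences P0 L0 \<le> incidences P L"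
      using extend_configuration[OF 0] by blast
    moreover from this I have "real (incidences P L)
        \<ge> 1 / 4 ^ 8 * (real m powr (2/3) * real n powr (1/2) + real m + real n)"
      by (meson of_nat_mono order_trans)
    ultimately show "\<exists>P L. finite P \<and> card P = m \<and> finite L \<and> card L = n \<and> (\<forall>l\<in>L. is_line l) \<and>
        (\<forall>H. is_plane H \<longrightarrow> card {l \<in> L. l \<subseteq> H} \<le> 2) \<and>
        real (incidences P L)
          \<ge> 1 / 4 ^ 8 * (real m powr (2/3) * real n powr (1/2) + real m + real n)"
      by blast
  qed simp
qed

end
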